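(* Let $\underline\lambda,\overline\lambda\in\mathbb{R}_{\ge 0}$ with $\underline\lambda\le\overline\lambda$. For any two time points $s,t\in\mathbb{R}_{\ge 0}$ with $s\le t$, $$\overline{\mathrm E}_{[\underline\lambda,\overline\lambda]}[N_t-N_s\mid s]=\overline\lambda(t-s)\quad\text{and}\quad\underline{\mathrm E}_{[\underline\lambda,\overline\lambda]}[N_t-N_s\mid s]=\underline\lambda(t-s)$$ (equalities holding at every $\omega\in\Omega$).
   Context: Conventions: $\mathbb{N}=\{1,2,\dots\}$; $\mathbb{R}_{\ge 0}=[0,+\infty)$; $\overline{\mathbb{R}}=\mathbb{R}\cup\{-\infty,+\infty\}$ with $+\infty-\infty=+\infty$; $\inf\emptyset=+\infty$; "increasing" means nondecreasing. Paths and variables. $\Omega$ is the set of counting paths: maps $\omega\colon\mathbb{R}_{\ge 0}\to\mathbb{Z}_{\ge 0}$ with $\omega(0)=0$ that are nondecreasing with unit jumps (every jump has size $1$) and right-continuous. A (partial) extended real variable is a map from (a subset of) $\Omega$ to $\overline{\mathbb{R}}$; "real" means it takes values in $\mathbb{R}$. For $t\in\mathbb{R}_{\ge 0}$, $N_t(\omega)=\omega(t)$. A stopping time is a map $\tau\colon\Omega\to[0,+\infty]$ such that for all $\omega_1,\omega_2\in\Omega$, if $\omega_1,\omega_2$ agree on $[0,\tau(\omega_1)]\cap\mathbb{R}_{\ge 0}$ then $\tau(\omega_1)=\tau(\omega_2)$; every $t\in\mathbb{R}_{\ge 0}$ is identified with the constant stopping time $t$. For a real-valued stopping time $\sigma$,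 $N_\sigma(\omega)=\omega(\sigma(\omega))$. For a stopping time $\tau$ and $\omega\in\Omega$, $\mathcal{I}_\tau(\omega)$ is the set of $\varpi\in\Omega$ that agree with $\omega$ on $[0,\tau(\omega)]\cap\mathbb{R}_{\ge 0}$. A partial variable $f$ is $\tau$-measurable if $f(\omega_1)=f(\omega_2)$ for all $\omega_1,\omega_2\in\operatorname{dom}f$ that agree on $[0,\tau(\omega_1)]\cap\mathbb{R}_{\ge 0}$. $\{\tau<+\infty\}=\{\omega\in\Omega:\tau(\omega)<+\infty\}$, and $\overline{\mathbb{V}}_\tau$ is the set of extended real partial variables whose domain includes $\{\tau<+\infty\}$. A process is a family $\mathcal{S}_\bullet=(\mathcal{S}_t)_{t\in\mathbb{R}_{\ge 0}}$ of real variables on $\Omega$ with $\mathcal{S}_t$ $t$-measurable for all $t$; $\inf\mathcal{S}_\bullet=\inf_{t,\omega}\mathcal{S}_t(\omega)$; $\mathcal{S}_\tau(\omega)=\mathcal{S}_{\tau(\omega)}(\omega)$ for $\omega\in\{\tau<+\infty\}$; $\liminf\mathcal{S}_\bullet(\omega)=\liminf_{t\to+\infty}\mathcal{S}_t(\omega)$. Capital processes. A one-sided elementary trading strategy $G$ consists of finitely many stopping times $\tau_1\le\tau_2\le\cdots\le\tau_{n+1}$ ($n\in\mathbb{N}$) and stakes $\overline h_1,\underline h_1,\dots,\overline h_n,\underline h_n$, where $\overline h_k,\underline h_k$ are $\tau_k$-measurable bounded nonnegative real (possibly partial) variables whose domains include $\{\tau_k<+\infty\}$. With initial capital $c\in\mathbb{R}$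 its capital process is $$\mathcal{K}^{G,c}_t=c+\sum_{k=1}^n\Big(\overline h_k\big(N_{\tau_{k+1}\wedge t}-N_{\tau_k\wedge t}-\overline\lambda(\tau_{k+1}\wedge t-\tau_k\wedge t)\big)+\underline h_k\big(\underline\lambda(\tau_{k+1}\wedge t-\tau_k\wedge t)-N_{\tau_{k+1}\wedge t}+N_{\tau_k\wedge t}\big)\Big),$$ where terms with $\tau_k(\omega)\wedge t=\tau_{k+1}(\omega)\wedge t$ count as zero. $\mathfrak{K}_{[\underline\lambda,\overline\lambda]}$ is the set of all such processes $\mathcal{K}^{G,c}_\bullet$. Upper and lower expectation. For a stopping time $\tau$, $f\in\overline{\mathbb{V}}_\tau$ and $\omega\in\{\tau<+\infty\}$, $$\overline{\mathrm E}_{[\underline\lambda,\overline\lambda]}[f\mid\tau](\omega)=\inf\{\mathcal{K}_\tau(\omega):\mathcal{K}_\bullet\in\mathfrak{K}_{[\underline\lambda,\overline\lambda]},\ \inf\mathcal{K}_\bullet>-\infty,\ \liminf\mathcal{K}_\bullet(\varpi)\ge f(\varpi)\ \forall\varpi\in\mathcal{I}_\tau(\omega)\},$$ and $\underline{\mathrm E}_{[\underline\lambda,\overline\lambda]}[f\mid\tau](\omega)=-\overline{\mathrm E}_{[\underline\lambda,\overline\lambda]}[-f\mid\tau](\omega)$. *)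

theory Defs
  imports Complex_Main "HOL-Library.Extended_Nonnegative_Real"
begin

text \<open>
  Time points are reals \<open>t \<ge> 0\<close>. Paths are extended by \<open>0\<close> to negative arguments, so that two
  paths are equal as soon as they agree on the nonnegative reals. The left limit in the
  unit-jump condition always exists for a nondecreasing path.
\<close>

typedef counting_path =
  "{w :: real \<Rightarrow> nat. (\<forall>t<0. w t = 0) \<and> w 0 = 0 \<and> mono_on {0..} w \<and>
     (\<forall>t\<ge>0. continuous (at_right t) w) \<and>
     (\<forall>t>0. \<exists>l. (w \<longlongrightarrow> l) (at_left t) \<and> (w t = l \<or> w t = l + 1))}"
  morphisms path_at Abs_counting_path
  by (rule exI[of _ "\<lambda>_. 0"]) (simp add: monotone_on_def)

definition N :: "real \<Rightarrow> counting_path \<Rightarrow> real" where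
  "N t \<omega> = real (path_at \<omega> t)"

definition agree_upto :: "ennreal \<Rightarrow> counting_path \<Rightarrow> counting_path \<Rightarrow> bool" where
  "agree_upto u \<omega>1 \<omega>2 \<longleftrightarrow> (\<forall>r\<ge>0. ennreal r \<le> u \<longrightarrow> path_at \<omega>1 r = path_at \<omega>2 r)"

definition stopping_time :: "(counting_path \<Rightarrow> ennreal) \<Rightarrow> bool" where
  "stopping_time \<tau> \<longleftrightarrow> (\<forall>\<omega>1 \<omega>2. agree_upto (\<tau> \<omega>1) \<omega>1 \<omega>2 \<longrightarrow> \<tau> \<omega>1 = \<tau> \<omega>2)"

definition const_time :: "real \<Rightarrow> counting_path \<Rightarrow> ennreal" where
  "const_time t = (\<lambda>_. ennreal t)"

text \<open>The real value of the minimum of \<open>\<tau>\<close> and the time point \<open>t\<close>.\<close>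

definition stopped :: "(counting_path \<Rightarrow> ennreal) \<Rightarrow> real \<Rightarrow> counting_path \<Rightarrow> real" where
  "stopped \<tau> t \<omega> = enn2real (min (\<tau> \<omega>) (ennreal t))"

definition indist :: "(counting_path \<Rightarrow> ennreal) \<Rightarrow> counting_path \<Rightarrow> counting_path set" where
  "indist \<tau> \<omega> = {\<omega>'. agree_upto (\<tau> \<omega>) \<omega> \<omega>'}"

definition stop_measurable ::
    "(counting_path \<Rightarrow> ennreal) \<Rightarrow> (counting_path \<rightharpoonup> 'a) \<Rightarrow> bool" where
  "stop_measurable \<tau> f \<longleftrightarrow>
     (\<forall>\<omega>1\<in>dom f. \<forall>\<omega>2\<in>dom f. agree_upto (\<tau> \<omega>1) \<omega>1 \<omega>2 \<longrightarrow> f \<omega>1 = f \<omega>2)"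

definition stake :: "(counting_path \<Rightarrow> ennreal) \<Rightarrow> (counting_path \<rightharpoonup> real) \<Rightarrow> bool" where
  "stake \<tau> h \<longleftrightarrow> {\<omega>. \<tau> \<omega> < \<infinity>} \<subseteq> dom h \<and> stop_measurable \<tau> h \<and>
     (\<exists>B. \<forall>x\<in>ran h. 0 \<le> x \<and> x \<le> B)"

text \<open>
  The times \<open>\<tau>\<close> are used at the indices \<open>1, \<dots>, n + 1\<close> and the stakes at \<open>1, \<dots>, n\<close>; \<open>gu\<close> are the
  overlined stakes (gain \<open>N\<^sub>b - N\<^sub>a - hi * (b - a)\<close> per unit over a period from \<open>a\<close> to \<open>b\<close>), \<open>gd\<close> the
  underlined ones (gain \<open>lo * (b - a) - N\<^sub>b + N\<^sub>a\<close>).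
\<close>

definition elementary_strategy ::
    "nat \<Rightarrow> (nat \<Rightarrow> counting_path \<Rightarrow> ennreal) \<Rightarrow> (nat \<Rightarrow> counting_path \<rightharpoonup> real) \<Rightarrow>
     (nat \<Rightarrow> counting_path \<rightharpoonup> real) \<Rightarrow> bool" where
  "elementary_strategy n \<tau> gu gd \<longleftrightarrow> n \<ge> 1 \<and>
     (\<forall>k\<in>{1..n+1}. stopping_time (\<tau> k)) \<and>
     (\<forall>k\<in>{1..n}. \<forall>\<omega>. \<tau> k \<omega> \<le> \<tau> (k + 1) \<omega>) \<and>
     (\<forall>k\<in>{1..n}. stake (\<tau> k) (gu k) \<and> stake (\<tau> k) (gd k))"

text \<open>
  A summand with \<open>a \<noteq> b\<close> has \<open>\<tau> k \<omega> < \<infinity>\<close>, so its stakes are defined at \<open>\<omega>\<close>.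
\<close>

definition capital ::
    "real \<Rightarrow> real \<Rightarrow> nat \<Rightarrow> (nat \<Rightarrow> counting_path \<Rightarrow> ennreal) \<Rightarrow>
     (nat \<Rightarrow> counting_path \<rightharpoonup> real) \<Rightarrow> (nat \<Rightarrow> counting_path \<rightharpoonup> real) \<Rightarrow> real \<Rightarrow>
     real \<Rightarrow> counting_path \<Rightarrow> real" where
  "capital lo hi n \<tau> gu gd c t \<omega> = c +
     (\<Sum>k=1..n. let a = stopped (\<tau> k) t \<omega>; b = stopped (\<tau> (k + 1)) t \<omega> in
        if a = b then 0
        else the (gu k \<omega>) * (N b \<omega> - N a \<omega> - hi * (b - a)) +
             the (gd k \<omega>) * (lo * (b - a) - N b \<omega> + N a \<omega>))"

definition capital_processes :: "real \<Rightarrow> real \<Rightarrow> (real \<Rightarrow> counting_path \<Rightarrow> real) set" where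
  "capital_processes lo hi =
     {capital lo hi n \<tau> gu gd c | n \<tau> gu gd c. elementary_strategy n \<tau> gu gd}"

definition process_Inf :: "(real \<Rightarrow> counting_path \<Rightarrow> real) \<Rightarrow> ereal" where
  "process_Inf S = (INF t\<in>{0..}. INF \<omega>. ereal (S t \<omega>))"

definition process_liminf :: "(real \<Rightarrow> counting_path \<Rightarrow> real) \<Rightarrow> counting_path \<Rightarrow> ereal" where
  "process_liminf S \<omega> = Liminf at_top (\<lambda>t. ereal (S t \<omega>))"

text \<open>
  Meaningful when \<open>\<tau>\<close> is a stopping time, \<open>\<tau> \<omega> < \<infinity>\<close>, and the domain of \<open>f\<close> includes all paths
  with finite \<open>\<tau>\<close>; then \<open>f\<close> is defined on the whole of \<open>indist \<tau> \<omega>\<close>.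
\<close>

definition upper_expectation ::
    "real \<Rightarrow> real \<Rightarrow> (counting_path \<rightharpoonup> ereal) \<Rightarrow> (counting_path \<Rightarrow> ennreal) \<Rightarrow>
     counting_path \<Rightarrow> ereal" where
  "upper_expectation lo hi f \<tau> \<omega> =
     Inf {ereal (K (enn2real (\<tau> \<omega>)) \<omega>) | K.
            K \<in> capital_processes lo hi \<and> process_Inf K > -\<infinity> \<and>
            (\<forall>\<omega>'\<in>indist \<tau> \<omega>. process_liminf K \<omega>' \<ge> the (f \<omega>'))}"

definition lower_expectation ::
    "real \<Rightarrow> real \<Rightarrow> (counting_path \<rightharpoonup> ereal) \<Rightarrow> (counting_path \<Rightarrow> ennreal) \<Rightarrow>
     counting_path \<Rightarrow> ereal" where
  "lower_expectation lo hi f \<tau> \<omega> =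
     - upper_expectation lo hi (\<lambda>\<omega>'. map_option uminus (f \<omega>')) \<tau> \<omega>"

end

theory Submission
  imports Defs
begin

text \<open>
  The upper bounds are superhedges. Buying one unit of \<open>N - hi * time\<close> over \<open>[s, t]\<close> with initial
  capital \<open>hi * (t - s)\<close> reproduces \<open>N t - N s\<close> and never falls below zero. Selling one unit of
  \<open>N - lo * time\<close> would reproduce \<open>- (N t - N s)\<close> from \<open>- lo * (t - s)\<close>, but its losses are
  unbounded because a path may have any number of jumps. It is therefore stopped at the \<open>M\<close>-th jump
  after \<open>s\<close>, and the premium \<open>lo * (t - s)\<close> lost by stopping early is covered by an extra long stake
  \<open>lo * (t - s) / M\<close>, whose cost tends to \<open>0\<close> as \<open>M\<close> grows
  (\<open>upper_expectation_neg_increment_le\<close>).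

  For the lower bounds, fix a rate \<open>r\<close> between \<open>lo\<close> and \<open>hi\<close>, a target \<open>q * (N t - N s)\<close> and a
  strategy. Strategies need not be measurable with respect to any probability measure, so instead of
  a Poisson process of rate \<open>r\<close> a single adversarial path is constructed. It may jump only on a grid
  of small mesh \<open>d\<close> to the right of \<open>s\<close>, and it jumps at a grid point iff the net long stake in force
  there is below the weight \<open>w\<close> of a jump in the target: \<open>q\<close> up to time \<open>t\<close>, and \<open>0\<close> afterwards. The
  adversary can follow this rule because a stake in force at a time is fixed by the path strictly
  before that time (\<open>adversarial_jumps\<close>).

  While the stake and the weight are constant, the path has either no jumps, when the strategy is
  long relative to the target, or jumps at every grid point, hence at least at rate \<open>r\<close>, when it is
  short. Both are unfavourable: relative to the target, compensated at rate \<open>r\<close>, the strategy gains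
  at most an error of order \<open>d\<close> (\<open>gain_on_uniform_jumps\<close>). An elementary strategy has finitely many
  periods, so the total error is of order \<open>d\<close> at all times \<open>u \<ge> t\<close> simultaneously, which bounds the
  lower limit of the capital (\<open>profit_le_on_adversarial_path\<close>). Letting \<open>d\<close> tend to \<open>0\<close>, a strategy
  that superhedges the target on every path must hold at least \<open>q * r * (t - s)\<close> at time \<open>s\<close>
  (\<open>upper_expectation_ge_rate\<close>). The theorem uses \<open>q = 1\<close>, \<open>r = hi\<close> and \<open>q = -1\<close>, \<open>r = lo\<close>.
\<close>

section \<open>Counting paths\<close>

lemma path_at_mono: "0 \<le> a \<Longrightarrow> a \<le> b \<Longrightarrow> path_at \<omega> a \<le> path_at \<omega> b"
  using path_at[of \<omega>] by (auto simp: monotone_on_def)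

lemma path_at_neg: "a < 0 \<Longrightarrow> path_at \<omega> a = 0"
  using path_at[of \<omega>] by auto

lemma path_at_0: "path_at \<omega> 0 = 0"
  using path_at[of \<omega>] by auto

lemma path_at_right_constant:
  "0 \<le> a \<Longrightarrow> \<forall>\<^sub>F x in at_right a. path_at \<omega> x = path_at \<omega> a"
  using path_at[of \<omega>] by (auto simp: continuous_within tendsto_discrete)

lemma path_at_left_constant:
  assumes "0 < a"
  obtains l where "\<forall>\<^sub>F x in at_left a. path_at \<omega> x = l" "path_at \<omega> a = l \<or> path_at \<omega> a = l + 1"
  using path_at[of \<omega>] assms by (auto simp: tendsto_discrete)

lemma N_mono: "0 \<le> a \<Longrightarrow> a \<le> b \<Longrightarrow> N a \<omega> \<le> N b \<omega>"
  by (simp add: N_def path_at_mono)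

text \<open>
  If \<open>\<tau> < T\<close>, then agreement on \<open>[0, T)\<close> includes agreement on the closed interval up to \<open>\<tau>\<close>. The
  half-open interval is what is needed when whether the path jumps at \<open>T\<close> is still to be decided.
\<close>

lemma stopping_time_determined_before:
  assumes "stopping_time \<tau>" "\<tau> \<omega>1 < ennreal T"
    and "\<And>x. 0 \<le> x \<Longrightarrow> x < T \<Longrightarrow> path_at \<omega>1 x = path_at \<omega>2 x"
  shows "\<tau> \<omega>2 = \<tau> \<omega>1" "agree_upto (\<tau> \<omega>1) \<omega>1 \<omega>2"
proof -
  have "x < T" if "0 \<le> x" "ennreal x \<le> \<tau> \<omega>1" for x
    using that assms(2) ennreal_less_iff[of x T] by auto
  then show *: "agree_upto (\<tau> \<omega>1) \<omega>1 \<omega>2"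
    using assms(3) by (auto simp: agree_upto_def)
  then show "\<tau> \<omega>2 = \<tau> \<omega>1"
    using assms(1) by (auto simp: stopping_time_def)
qed

lemma min_ennreal: "0 \<le> x \<Longrightarrow> 0 \<le> u \<Longrightarrow> min (ennreal x) (ennreal u) = ennreal (min x u)"
  by (simp add: min_def)

lemma stopped_less_iff:
  assumes "0 \<le> T" "T \<le> u"
  shows "stopped \<tau> u \<omega> < T \<longleftrightarrow> \<tau> \<omega> < ennreal T"
proof (cases "\<tau> \<omega>")
  case (real x)
  then show ?thesis using assms by (auto simp: stopped_def ennreal_less_iff min_ennreal)
next
  case top
  then show ?thesis using assms by (auto simp: stopped_def)
qed

lemma stopped_bounds:
  assumes "0 \<le> u" shows "0 \<le> stopped \<tau> u \<omega>" "stopped \<tau> u \<omega> \<le> u"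
proof -
  show "0 \<le> stopped \<tau> u \<omega>" by (simp add: stopped_def)
  have "\<not> stopped \<tau> u \<omega> > u"
    using enn2real_mono[of "min (\<tau> \<omega>) (ennreal u)" "ennreal u"] assms
    by (auto simp: stopped_def)
  then show "stopped \<tau> u \<omega> \<le> u" by simp
qed

lemma stopped_min:
  assumes "0 \<le> v" "v \<le> u"
  shows "stopped \<tau> v \<omega> = min (stopped \<tau> u \<omega>) v"
proof (cases "\<tau> \<omega>")
  case (real x)
  then show ?thesis using assms by (auto simp: stopped_def min_ennreal)
next
  case top
  then show ?thesis using assms by (auto simp: stopped_def)
qed

lemma stopped_ennreal:
  assumes "\<tau> \<omega> = ennreal x" "0 \<le> x" "0 \<le> u"
  shows "stopped \<tau> u \<omega> = min x u"
  using assms by (auto simp: stopped_def min_ennreal)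

lemma stopped_mono:
  assumes "\<tau> \<omega> \<le> \<tau>' \<omega>" shows "stopped \<tau> u \<omega> \<le> stopped \<tau>' u \<omega>"
  unfolding stopped_def by (rule enn2real_mono) (use assms in \<open>auto simp: min_less_iff_disj intro: min.coboundedI1\<close>)


section \<open>Paths with prescribed jumps on a grid\<close>

text \<open>
  The grid points are \<open>s + (i + 1) * d\<close>; the first one lies strictly after \<open>s\<close>, so the jumps do not
  disturb the path up to \<open>s\<close>. The floor counts the grid points up to time \<open>r\<close>; it is nonpositive for
  \<open>r < s + d\<close>, and truncation to \<open>nat\<close> then makes the counted set empty.
\<close>

definition jump_path :: "counting_path \<Rightarrow> real \<Rightarrow> real \<Rightarrow> nat set \<Rightarrow> counting_path" where
  "jump_path \<omega> s d J = Abs_counting_path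
     (\<lambda>r. path_at \<omega> (min r s) + card (J \<inter> {..<nat \<lfloor>(r - s) / d\<rfloor>}))"

lemma grid_point_le_iff:
  fixes s d r :: real
  assumes "0 < d"
  shows "s + (real i + 1) * d \<le> r \<longleftrightarrow> i < nat \<lfloor>(r - s) / d\<rfloor>"
proof -
  have "s + (real i + 1) * d \<le> r \<longleftrightarrow> of_int (int i + 1) \<le> (r - s) / d"
    using assms by (auto simp: field_simps)
  also have "\<dots> \<longleftrightarrow> int i + 1 \<le> \<lfloor>(r - s) / d\<rfloor>" by (simp only: le_floor_iff)
  also have "\<dots> \<longleftrightarrow> i < nat \<lfloor>(r - s) / d\<rfloor>" by linarith
  finally show ?thesis .
qed

lemma grid_index_right_constant:
  fixes s d r :: real
  assumes "0 < d"
  shows "\<forall>\<^sub>F x in at_right r. \<lfloor>(x - s) / d\<rfloor> = \<lfloor>(r - s) / d\<rfloor>"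
proof -
  define z where "z = s + (\<lfloor>(r - s) / d\<rfloor> + 1) * d"
  have "(r - s) / d < \<lfloor>(r - s) / d\<rfloor> + 1" by linarith
  then have "r < z" using assms by (simp add: z_def field_simps)
  moreover have "\<lfloor>(x - s) / d\<rfloor> = \<lfloor>(r - s) / d\<rfloor>" if "r < x" "x < z" for x
  proof -
    have "(r - s) / d \<le> (x - s) / d" using that assms by (simp add: divide_right_mono)
    moreover have "(x - s) / d < \<lfloor>(r - s) / d\<rfloor> + 1"
      using that assms by (simp add: z_def field_simps)
    ultimately show ?thesis by linarith
  qed
  ultimately show ?thesis by (auto simp: eventually_at_right[of r z])
qed

lemma grid_index_left_constant:
  fixes s d r :: real
  assumes "0 < d"
  shows "\<forall>\<^sub>F x in at_left r. \<lfloor>(x - s) / d\<rfloor> = \<lceil>(r - s) / d\<rceil> - 1"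
proof -
  define z where "z = s + (\<lceil>(r - s) / d\<rceil> - 1) * d"
  have "\<lceil>(r - s) / d\<rceil> - 1 < (r - s) / d" by linarith
  then have "z < r" using assms by (simp add: z_def field_simps)
  moreover have "\<lfloor>(x - s) / d\<rfloor> = \<lceil>(r - s) / d\<rceil> - 1" if "z < x" "x < r" for x
  proof -
    have "(x - s) / d < (r - s) / d" using that assms by (simp add: divide_strict_right_mono)
    moreover have "\<lceil>(r - s) / d\<rceil> - 1 < (x - s) / d"
      using that assms by (simp add: z_def field_simps)
    ultimately show ?thesis by linarith
  qed
  ultimately show ?thesis by (auto simp: eventually_at_left[of z r])
qed

text \<open>
  Between consecutive grid points the number of grid points passed is constant. This reduces the
  regularity of the new path after \<open>s\<close> to that of a step function, and each grid point adds at most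
  one element of \<open>J\<close>.
\<close>

lemma path_at_jump_path:
  assumes "0 \<le> s" "0 < d"
  shows "path_at (jump_path \<omega> s d J) r =
    path_at \<omega> (min r s) + card (J \<inter> {..<nat \<lfloor>(r - s) / d\<rfloor>})"
proof -
  let ?k = "\<lambda>r. nat \<lfloor>(r - s) / d\<rfloor>"
  let ?w = "\<lambda>r. path_at \<omega> (min r s) + card (J \<inter> {..<?k r})"
  have before: "?k x = 0" if "x \<le> s" for x
    using that assms by (simp add: divide_nonpos_pos floor_le_iff)
  have neg: "\<forall>x<0. ?w x = 0"
    using assms before by (auto simp: path_at_neg)
  have zero: "?w 0 = 0"
    using assms before[of 0] by (simp only: min_absorb1 path_at_0) simp
  have mono: "mono_on {0..} ?w"
  proof (rule mono_onI)
    fix x y :: real assume xy: "x \<in> {0..}" "y \<in> {0..}" "x \<le> y"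
    have "?k x \<le> ?k y"
      using xy assms by (intro nat_mono floor_mono divide_right_mono) auto
    then have "card (J \<inter> {..<?k x}) \<le> card (J \<inter> {..<?k y})"
      by (intro card_mono) auto
    moreover have "path_at \<omega> (min x s) \<le> path_at \<omega> (min y s)"
      using xy assms by (intro path_at_mono) auto
    ultimately show "?w x \<le> ?w y" by linarith
  qed
  have right: "\<forall>\<^sub>F x in at_right a. ?w x = ?w a" if "0 \<le> a" for a
  proof -
    have "\<forall>\<^sub>F x in at_right a. path_at \<omega> (min x s) = path_at \<omega> (min a s)"
    proof (cases "a < s")
      case True
      then have "\<forall>\<^sub>F x in at_right a. x < s" by (auto simp: eventually_at_right[of a s])
      with path_at_right_constant[OF that, of \<omega>] show ?thesis
        by eventually_elim (use True in auto)
    next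
      case False
      have "\<forall>\<^sub>F x in at_right a. a < x" by (simp add: eventually_at_right_less)
      then show ?thesis by eventually_elim (use False in auto)
    qed
    with grid_index_right_constant[OF assms(2), of s a]
    show ?thesis by eventually_elim auto
  qed
  have left: "\<exists>l. (\<forall>\<^sub>F x in at_left a. ?w x = l) \<and> (?w a = l \<or> ?w a = l + 1)" if pos: "0 < a" for a
  proof (cases "a \<le> s")
    case True
    obtain l where l: "\<forall>\<^sub>F x in at_left a. path_at \<omega> x = l"
        "path_at \<omega> a = l \<or> path_at \<omega> a = l + 1"
      using path_at_left_constant[OF pos] by blast
    have "\<forall>\<^sub>F x in at_left a. x < a" using pos by (auto simp: eventually_at_left[of 0 a])
    with l(1) have "\<forall>\<^sub>F x in at_left a. ?w x = l"
      by eventually_elim (use True before in auto)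
    moreover have "?w a = path_at \<omega> a" using True before by auto
    ultimately show ?thesis using l(2) by auto
  next
    case False
    let ?c = "\<lceil>(a - s) / d\<rceil> - 1"
    have c0: "0 \<le> ?c" using False assms by (simp add: less_ceiling_iff[of 0, simplified])
    have "\<forall>\<^sub>F x in at_left a. s < x" using False by (intro eventually_at_leftI[of s]) auto
    with grid_index_left_constant[OF assms(2), of s a]
    have ev: "\<forall>\<^sub>F x in at_left a. ?w x = path_at \<omega> s + card (J \<inter> {..<nat ?c})"
      by eventually_elim auto
    have "\<lfloor>(a - s) / d\<rfloor> = ?c \<or> \<lfloor>(a - s) / d\<rfloor> = ?c + 1" by linarith
    then have "?k a = nat ?c \<or> ?k a = Suc (nat ?c)" using c0 by linarith
    then have "card (J \<inter> {..<?k a}) = card (J \<inter> {..<nat ?c}) \<or>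
               card (J \<inter> {..<?k a}) = card (J \<inter> {..<nat ?c}) + 1"
      by (auto simp: lessThan_Suc Int_insert_right)
    with ev False show ?thesis by auto
  qed
  have "?w \<in> {w :: real \<Rightarrow> nat. (\<forall>t<0. w t = 0) \<and> w 0 = 0 \<and> mono_on {0..} w \<and>
     (\<forall>t\<ge>0. continuous (at_right t) w) \<and>
     (\<forall>t>0. \<exists>l. (w \<longlongrightarrow> l) (at_left t) \<and> (w t = l \<or> w t = l + 1))}"
    using neg zero mono right left
    unfolding mem_Collect_eq continuous_within tendsto_discrete by blast
  from Abs_counting_path_inverse[OF this] show ?thesis by (simp add: jump_path_def)
qed

lemma jump_path_agree_start:
  assumes "0 \<le> s" "0 < d" shows "agree_upto (ennreal s) \<omega> (jump_path \<omega> s d J)"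
proof -
  have "path_at \<omega> x = path_at (jump_path \<omega> s d J) x" if "x \<le> s" for x
  proof -
    have "\<lfloor>(x - s) / d\<rfloor> \<le> 0" using that assms by (simp add: divide_nonpos_pos floor_le_iff)
    then show ?thesis using that by (simp add: path_at_jump_path[OF assms])
  qed
  then show ?thesis using assms by (auto simp: agree_upto_def)
qed

lemma jump_path_restrict:
  assumes "0 \<le> s" "0 < d" "x < s + (real i + 1) * d"
  shows "path_at (jump_path \<omega> s d (J \<inter> {..<i})) x = path_at (jump_path \<omega> s d J) x"
proof -
  have "\<not> i < nat \<lfloor>(x - s) / d\<rfloor>"
    using grid_point_le_iff[OF assms(2), of s i x] assms(3) by simp
  then have "J \<inter> {..<i} \<inter> {..<nat \<lfloor>(x - s) / d\<rfloor>} = J \<inter> {..<nat \<lfloor>(x - s) / d\<rfloor>}" by auto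
  then show ?thesis by (simp add: path_at_jump_path assms)
qed

text \<open>
  The set of indices below \<open>i\<close> that are chosen when each index is decided in turn, knowing the
  earlier choices.
\<close>

primrec decided :: "(nat \<Rightarrow> nat set \<Rightarrow> bool) \<Rightarrow> nat \<Rightarrow> nat set" where
  "decided Q 0 = {}"
| "decided Q (Suc i) = (if Q i (decided Q i) then insert i (decided Q i) else decided Q i)"

lemma sequential_choice:
  fixes Q :: "nat \<Rightarrow> nat set \<Rightarrow> bool"
  shows "\<exists>J. \<forall>i. i \<in> J \<longleftrightarrow> Q i (J \<inter> {..<i})"
proof -
  define J where "J = {i. Q i (decided Q i)}"
  have "J \<inter> {..<i} = decided Q i" for i
    by (induction i) (auto simp: J_def lessThan_Suc Int_insert_right)
  then have "\<forall>i. i \<in> J \<longleftrightarrow> Q i (J \<inter> {..<i})" by (simp add: J_def)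
  then show ?thesis ..
qed


section \<open>Strategies whose periods cover the whole time axis\<close>

text \<open>
  Over a period with stakes \<open>gu\<close> and \<open>gd\<close>, the capital changes by the difference of this function at
  the end and at the beginning of the period. In this form profits telescope.
\<close>

definition gain :: "real \<Rightarrow> real \<Rightarrow> real \<Rightarrow> real \<Rightarrow> counting_path \<Rightarrow> real \<Rightarrow> real" where
  "gain lo hi gu gd \<omega> x = gu * (N x \<omega> - hi * x) + gd * (lo * x - N x \<omega>)"

text \<open>
  Elementary strategies in a form suited to summation over the whole time axis: the periods run from
  time \<open>0\<close> to infinity, so that their parts up to any \<open>u\<close> cover \<open>[0, u]\<close>, and the stakes are total
  functions. The bound \<open>B k\<close> on the short stake controls how much the strategy can gain when
  the grid path has too few jumps in period \<open>k\<close>.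
\<close>

locale covering_strategy =
  fixes m :: nat and \<tau> :: "nat \<Rightarrow> counting_path \<Rightarrow> ennreal"
    and up dn :: "nat \<Rightarrow> counting_path \<Rightarrow> real" and B :: "nat \<Rightarrow> real"
  assumes first: "\<tau> 0 = (\<lambda>_. 0)" and last: "\<tau> m = (\<lambda>_. \<infinity>)"
    and stopping: "\<And>k. stopping_time (\<tau> k)"
    and mono: "\<And>k \<omega>. \<tau> k \<omega> \<le> \<tau> (Suc k) \<omega>"
    and up_determined:
      "\<And>k \<omega>1 \<omega>2. \<tau> k \<omega>1 < \<infinity> \<Longrightarrow> agree_upto (\<tau> k \<omega>1) \<omega>1 \<omega>2 \<Longrightarrow> up k \<omega>1 = up k \<omega>2"
    and dn_determined:
      "\<And>k \<omega>1 \<omega>2. \<tau> k \<omega>1 < \<infinity> \<Longrightarrow> agree_upto (\<tau> k \<omega>1) \<omega>1 \<omega>2 \<Longrightarrow> dn k \<omega>1 = dn k \<omega>2"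
    and up_nonneg: "\<And>k \<omega>. 0 \<le> up k \<omega>" and dn_nonneg: "\<And>k \<omega>. 0 \<le> dn k \<omega>"
    and dn_le: "\<And>k \<omega>. dn k \<omega> \<le> B k"
begin

definition profit :: "real \<Rightarrow> real \<Rightarrow> real \<Rightarrow> counting_path \<Rightarrow> real" where
  "profit lo hi u \<omega> = (\<Sum>k<m.
     gain lo hi (up k \<omega>) (dn k \<omega>) \<omega> (stopped (\<tau> (Suc k)) u \<omega>) -
     gain lo hi (up k \<omega>) (dn k \<omega>) \<omega> (stopped (\<tau> k) u \<omega>))"

text \<open>
  Periods that begin before \<open>s\<close> have the same beginning and stakes on both paths; the others
  contribute nothing up to time \<open>s\<close>.
\<close>

lemma profit_determined:
  assumes "0 \<le> s" and ag: "agree_upto (ennreal s) \<omega> W"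
  shows "profit lo hi s \<omega> = profit lo hi s W"
proof -
  have agN: "N y \<omega> = N y W" if "0 \<le> y" "y \<le> s" for y
    using ag that by (auto simp: agree_upto_def N_def ennreal_leI)
  have *: "stopped (\<tau> k) s \<omega> = stopped (\<tau> k) s W \<and>
    (\<tau> k \<omega> < ennreal s \<longrightarrow> up k \<omega> = up k W \<and> dn k \<omega> = dn k W)" for k
  proof (cases "\<tau> k \<omega> < ennreal s")
    case True
    have "path_at \<omega> y = path_at W y" if "0 \<le> y" "y < s" for y
      using ag that by (auto simp: agree_upto_def ennreal_leI)
    from stopping_time_determined_before[OF stopping True this]
    have "\<tau> k W = \<tau> k \<omega>" "agree_upto (\<tau> k \<omega>) \<omega> W" by auto
    moreover have "\<tau> k \<omega> < \<infinity>"
      using less_trans[OF True ennreal_less_top] by simp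
    ultimately show ?thesis using up_determined dn_determined by (auto simp: stopped_def)
  next
    case False
    have "\<not> \<tau> k W < ennreal s"
    proof
      assume a: "\<tau> k W < ennreal s"
      have "path_at W y = path_at \<omega> y" if "0 \<le> y" "y < s" for y
        using ag that by (auto simp: agree_upto_def ennreal_leI)
      from stopping_time_determined_before(1)[OF stopping a this] False a show False by auto
    qed
    with False show ?thesis by (simp add: stopped_def min_absorb2)
  qed
  have "gain lo hi (up k \<omega>) (dn k \<omega>) \<omega> (stopped (\<tau> (Suc k)) s \<omega>) -
    gain lo hi (up k \<omega>) (dn k \<omega>) \<omega> (stopped (\<tau> k) s \<omega>) =
    gain lo hi (up k W) (dn k W) W (stopped (\<tau> (Suc k)) s W) -
    gain lo hi (up k W) (dn k W) W (stopped (\<tau> k) s W)" for k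
  proof (cases "\<tau> k \<omega> < ennreal s")
    case True
    then show ?thesis using * stopped_bounds[OF \<open>0 \<le> s\<close>, of _ W]
      by (simp add: gain_def agN)
  next
    case False
    then have "ennreal s \<le> \<tau> (Suc k) \<omega>" using mono[of k \<omega>] by auto
    with False have "stopped (\<tau> (Suc k)) s \<omega> = stopped (\<tau> k) s \<omega>"
      by (simp add: stopped_def min_absorb2)
    then show ?thesis using *[of k] *[of "Suc k"] by simp
  qed
  then show ?thesis by (simp add: profit_def)
qed

end


text \<open>
  Two periods with zero stakes are added, one before \<open>\<tau> 1\<close> and one after \<open>\<tau> (n + 1)\<close>. A stake is set
  to zero where its period never begins.
\<close>

lemma capital_eq_covering_profit:
  assumes strat: "elementary_strategy n \<tau> gu gd"
  obtains \<tau>' :: "nat \<Rightarrow> counting_path \<Rightarrow> ennreal" and up dn :: "nat \<Rightarrow> counting_path \<Rightarrow> real"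
    and B :: "nat \<Rightarrow> real"
  where "covering_strategy (n + 2) \<tau>' up dn B"
    "\<And>u \<omega>. 0 \<le> u \<Longrightarrow>
       capital lo hi n \<tau> gu gd c u \<omega> = c + covering_strategy.profit (n + 2) \<tau>' up dn lo hi u \<omega>"
proof -
  define \<tau>' where "\<tau>' k \<omega> = (if k = 0 then 0 else if k \<le> n + 1 then \<tau> k \<omega> else \<infinity>)" for k \<omega>
  define ext :: "(nat \<Rightarrow> counting_path \<rightharpoonup> real) \<Rightarrow> nat \<Rightarrow> counting_path \<Rightarrow> real"
    where "ext g k \<omega> = (if 1 \<le> k \<and> k \<le> n \<and> \<tau> k \<omega> < \<infinity> then the (g k \<omega>) else 0)" for g k \<omega>
  from strat have st: "\<And>k. 1 \<le> k \<Longrightarrow> k \<le> n + 1 \<Longrightarrow> stopping_time (\<tau> k)"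
    and mono: "\<And>k \<omega>. 1 \<le> k \<Longrightarrow> k \<le> n \<Longrightarrow> \<tau> k \<omega> \<le> \<tau> (k + 1) \<omega>"
    and gu: "\<And>k. 1 \<le> k \<Longrightarrow> k \<le> n \<Longrightarrow> stake (\<tau> k) (gu k)"
    and gd: "\<And>k. 1 \<le> k \<Longrightarrow> k \<le> n \<Longrightarrow> stake (\<tau> k) (gd k)"
    by (auto simp: elementary_strategy_def)
  have st': "stopping_time (\<tau>' k)" for k
    using st[of k] by (cases "k = 0"; cases "k \<le> n + 1") (auto simp: \<tau>'_def stopping_time_def)
  have mono': "\<tau>' k \<omega> \<le> \<tau>' (Suc k) \<omega>" for k \<omega>
    using mono[of k \<omega>] by (auto simp: \<tau>'_def)
  have ext_meas: "ext g k \<omega>1 = ext g k \<omega>2"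
    if g: "\<And>k. 1 \<le> k \<Longrightarrow> k \<le> n \<Longrightarrow> stake (\<tau> k) (g k)"
      and fin: "\<tau>' k \<omega>1 < \<infinity>" and ag: "agree_upto (\<tau>' k \<omega>1) \<omega>1 \<omega>2" for g k \<omega>1 \<omega>2
  proof (cases "1 \<le> k \<and> k \<le> n")
    case True
    with ag fin have ag: "agree_upto (\<tau> k \<omega>1) \<omega>1 \<omega>2" and fin: "\<tau> k \<omega>1 < \<infinity>"
      by (auto simp: \<tau>'_def)
    with st[of k] True have "\<tau> k \<omega>2 = \<tau> k \<omega>1" by (auto simp: stopping_time_def)
    have "stake (\<tau> k) (g k)" using g True by blast
    moreover from this have "\<omega>1 \<in> dom (g k)" "\<omega>2 \<in> dom (g k)"
      using fin \<open>\<tau> k \<omega>2 = \<tau> k \<omega>1\<close> unfolding stake_def by (metis (mono_tags) mem_Collect_eq subsetD)+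
    ultimately have "g k \<omega>1 = g k \<omega>2"
      using ag unfolding stake_def stop_measurable_def by blast
    with \<open>\<tau> k \<omega>2 = \<tau> k \<omega>1\<close> show ?thesis by (simp add: ext_def)
  qed (auto simp: ext_def)
  have ext_bdd: "\<exists>B. \<forall>\<omega>. 0 \<le> ext g k \<omega> \<and> ext g k \<omega> \<le> B"
    if g: "\<And>k. 1 \<le> k \<Longrightarrow> k \<le> n \<Longrightarrow> stake (\<tau> k) (g k)" for g k
  proof (cases "1 \<le> k \<and> k \<le> n")
    case True
    then have "stake (\<tau> k) (g k)" using g by blast
    then obtain B where B: "\<And>x. x \<in> ran (g k) \<Longrightarrow> 0 \<le> x \<and> x \<le> B"
      and dom: "{\<omega>. \<tau> k \<omega> < \<infinity>} \<subseteq> dom (g k)" unfolding stake_def by blast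
    have "0 \<le> ext g k \<omega> \<and> ext g k \<omega> \<le> max 0 B" for \<omega>
    proof (cases "\<tau> k \<omega> < \<infinity>")
      case True
      with dom obtain y where "g k \<omega> = Some y" by auto
      then show ?thesis using B[of y] by (auto simp: ext_def ranI)
    qed (auto simp: ext_def)
    then show ?thesis by blast
  qed (auto simp: ext_def)
  obtain B where B: "\<And>k \<omega>. ext gd k \<omega> \<le> B k" using ext_bdd[OF gd] by metis
  have cap: "capital lo hi n \<tau> gu gd c u \<omega> = c + (\<Sum>k<n+2.
        gain lo hi (ext gu k \<omega>) (ext gd k \<omega>) \<omega> (stopped (\<tau>' (Suc k)) u \<omega>) -
        gain lo hi (ext gu k \<omega>) (ext gd k \<omega>) \<omega> (stopped (\<tau>' k) u \<omega>))" (is "_ = c + sum ?g _")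
    if "0 \<le> u" for lo hi c u \<omega>
  proof -
    have "(\<Sum>k=1..n. let a = stopped (\<tau> k) u \<omega>; b = stopped (\<tau> (k + 1)) u \<omega> in
        if a = b then 0
        else the (gu k \<omega>) * (N b \<omega> - N a \<omega> - hi * (b - a)) +
             the (gd k \<omega>) * (lo * (b - a) - N b \<omega> + N a \<omega>)) = sum ?g {1..n}"
    proof (rule sum.cong[OF refl])
      fix k assume k: "k \<in> {1..n}"
      then have eq: "\<tau>' k = \<tau> k" "\<tau>' (Suc k) = \<tau> (Suc k)" by (auto simp: \<tau>'_def)
      show "(let a = stopped (\<tau> k) u \<omega>; b = stopped (\<tau> (k + 1)) u \<omega> in
        if a = b then 0
        else the (gu k \<omega>) * (N b \<omega> - N a \<omega> - hi * (b - a)) +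
             the (gd k \<omega>) * (lo * (b - a) - N b \<omega> + N a \<omega>)) = ?g k"
      proof (cases "\<tau> k \<omega> < \<infinity>")
        case True
        then show ?thesis using k
          by (simp add: Let_def eq gain_def ext_def algebra_simps)
      next
        case False
        then have "\<tau> k \<omega> = \<infinity>" by (simp add: less_top[symmetric])
        moreover from this have "\<tau> (Suc k) \<omega> = \<infinity>" using mono[of k \<omega>] k by (simp add: top_unique)
        ultimately have "stopped (\<tau> k) u \<omega> = stopped (\<tau> (Suc k)) u \<omega>" by (simp add: stopped_def)
        then show ?thesis by (simp add: eq)
      qed
    qed
    also have "\<dots> = sum ?g {..<n+2}"
    proof (rule sum.mono_neutral_left)
      show "\<forall>k\<in>{..<n+2} - {1..n}. ?g k = 0"
        by (auto simp: ext_def gain_def)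
    qed auto
    finally show ?thesis by (simp add: capital_def)
  qed
  have cov: "covering_strategy (n + 2) \<tau>' (ext gu) (ext gd) B"
  proof
    show "\<tau>' 0 = (\<lambda>_. 0)" "\<tau>' (n + 2) = (\<lambda>_. \<infinity>)" by (auto simp: \<tau>'_def)
    show "0 \<le> ext gu k \<omega>" "0 \<le> ext gd k \<omega>" for k \<omega> using ext_bdd[OF gu] ext_bdd[OF gd] by auto
    show "ext gu k \<omega>1 = ext gu k \<omega>2" "ext gd k \<omega>1 = ext gd k \<omega>2"
      if "\<tau>' k \<omega>1 < \<infinity>" "agree_upto (\<tau>' k \<omega>1) \<omega>1 \<omega>2" for k \<omega>1 \<omega>2
      using ext_meas[OF gu] ext_meas[OF gd] that by blast+
  qed (use st' mono' B in auto)
  show ?thesis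
    by (rule that[OF cov]) (simp only: cap covering_strategy.profit_def[OF cov])
qed


section \<open>Every strategy has an adversarial path\<close>

text \<open>
  Write \<open>D\<close> for the number of jumps in \<open>(a, b]\<close>. The gain is at most
  \<open>(gu - gd) * (D - r * (b - a))\<close> because \<open>lo \<le> r \<le> hi\<close>. So the claim is that
  \<open>(gu - gd - q) * (D - r * (b - a))\<close> is at most of order \<open>d\<close>. If \<open>gu - gd \<ge> q\<close>, there are no jumps
  and the product is nonpositive. Otherwise all grid points are jumps, and since \<open>r * d \<le> 1\<close> they are
  dense enough for \<open>D \<ge> r * (b - a) - r * d\<close>; the defect \<open>r * d\<close> arises when the interval is too short
  to contain a grid point.
\<close>

lemma gain_on_uniform_jumps:
  fixes lo hi r q gu gd s d a b :: real
  assumes "0 \<le> lo" "lo \<le> r" "r \<le> hi" "0 \<le> gu" "0 \<le> gd" "0 < d" "r * d \<le> 1" "0 \<le> s"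
    and ab: "s \<le> a" "a \<le> b"
    and W: "W = jump_path \<omega> s d J"
    and rule: "\<And>i. a < s + (real i + 1) * d \<Longrightarrow> s + (real i + 1) * d \<le> b \<Longrightarrow>
                i \<in> J \<longleftrightarrow> gu - gd < q"
  shows "gain lo hi gu gd W b - gain lo hi gu gd W a
           \<le> q * (N b W - N a W) - q * r * (b - a) + (\<bar>q\<bar> + gd) * r * d"
proof -
  define ka where "ka = nat \<lfloor>(a - s) / d\<rfloor>"
  define kb where "kb = nat \<lfloor>(b - s) / d\<rfloor>"
  define D where "D = N b W - N a W"
  have le: "ka \<le> kb" unfolding ka_def kb_def
    using assms by (intro nat_mono floor_mono divide_right_mono) auto
  have inJ: "i \<in> J \<longleftrightarrow> gu - gd < q" if "ka \<le> i" "i < kb" for i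
    using rule[of i] that grid_point_le_iff[OF \<open>0 < d\<close>, of s i]
    by (metis ka_def kb_def not_le)
  have "J \<inter> {..<kb} = (J \<inter> {..<ka}) \<union> (J \<inter> {ka..<kb})" using le by auto
  then have "card (J \<inter> {..<kb}) = card (J \<inter> {..<ka}) + card (J \<inter> {ka..<kb})"
    by (simp add: card_Un_disjoint[symmetric] disjoint_iff)
  then have D: "D = card (J \<inter> {ka..<kb})"
    using assms by (simp add: D_def W N_def path_at_jump_path ka_def kb_def)
  have g: "gain lo hi gu gd W b - gain lo hi gu gd W a =
      (gu - gd) * D - (gu * hi - gd * lo) * (b - a)"
    by (simp add: gain_def D_def algebra_simps)
  have "(gu - gd) * r \<le> gu * hi - gd * lo"
    using mult_left_mono[OF \<open>r \<le> hi\<close> \<open>0 \<le> gu\<close>] mult_left_mono[OF \<open>lo \<le> r\<close> \<open>0 \<le> gd\<close>]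
    by (simp add: algebra_simps)
  then have h: "(gu - gd) * r * (b - a) \<le> (gu * hi - gd * lo) * (b - a)"
    using ab by (intro mult_right_mono) auto
  have err: "0 \<le> (\<bar>q\<bar> + gd) * r * d" using assms by simp
  show ?thesis
  proof (cases "gu - gd < q")
    case True
    then have "J \<inter> {ka..<kb} = {ka..<kb}" using inJ by auto
    then have Dk: "D = real kb - real ka" using D le by simp
    have "0 \<le> (a - s) / d" "0 \<le> (b - s) / d" using assms by auto
    then have "real kb > (b - s) / d - 1" "real ka \<le> (a - s) / d"
      unfolding ka_def kb_def by linarith+
    then have D1: "(b - a) / d - 1 \<le> D" using Dk by (simp add: diff_divide_distrib)
    have "r * (b - a) - r * d \<le> D"
    proof (cases "(b - a) / d - 1 \<le> 0")
      case True
      then have "b - a \<le> d" using \<open>0 < d\<close> by simp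
      then have "r * (b - a) \<le> r * d" using assms by (intro mult_left_mono) auto
      then show ?thesis using Dk le by simp
    next
      case False
      have "r * (b - a) - r * d = (r * d) * ((b - a) / d - 1)"
        using \<open>0 < d\<close> by (simp add: field_simps)
      also have "\<dots> \<le> 1 * ((b - a) / d - 1)"
        using False assms by (intro mult_right_mono) auto
      finally show ?thesis using D1 by simp
    qed
    then have "(q - (gu - gd)) * (r * (b - a) - r * d) \<le> (q - (gu - gd)) * D"
      using True by (intro mult_left_mono) auto
    moreover have "(q - (gu - gd)) * (r * d) \<le> (\<bar>q\<bar> + gd) * (r * d)"
      using assms by (intro mult_right_mono) auto
    ultimately show ?thesis using h unfolding g D_def[symmetric]
      by (simp add: algebra_simps)
  next
    case False
    then have "J \<inter> {ka..<kb} = {}" using inJ by auto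
    then have "D = 0" using D by simp
    moreover have "q * r * (b - a) \<le> (gu - gd) * r * (b - a)"
      using False assms by (intro mult_right_mono) auto
    ultimately show ?thesis using h err unfolding g D_def[symmetric] by simp
  qed
qed

context covering_strategy
begin

text \<open>
  The jump at the \<open>i\<close>-th grid point is decided by the stakes in force there on the provisional path
  that has no jumps from that point on. The provisional and the final path agree strictly before the
  point, and this already determines which period contains the point and the stakes of that period.
\<close>

lemma adversarial_jumps:
  fixes w :: "real \<Rightarrow> real"
  assumes s: "0 \<le> s" and d: "0 < d"
  obtains J where
    "\<And>k i. \<lbrakk>\<tau> k (jump_path \<omega> s d J) < ennreal (s + (real i + 1) * d);
             ennreal (s + (real i + 1) * d) \<le> \<tau> (Suc k) (jump_path \<omega> s d J)\<rbrakk>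
       \<Longrightarrow> i \<in> J \<longleftrightarrow> up k (jump_path \<omega> s d J) - dn k (jump_path \<omega> s d J) < w (s + (real i + 1) * d)"
proof -
  let ?T = "\<lambda>i. s + (real i + 1) * d"
  let ?W = "jump_path \<omega> s d"
  obtain J where J: "\<And>i. i \<in> J \<longleftrightarrow> (\<exists>k. \<tau> k (?W (J \<inter> {..<i})) < ennreal (?T i) \<and>
      ennreal (?T i) \<le> \<tau> (Suc k) (?W (J \<inter> {..<i})) \<and>
      up k (?W (J \<inter> {..<i})) - dn k (?W (J \<inter> {..<i})) < w (?T i))"
    using sequential_choice[of "\<lambda>i A. \<exists>k. \<tau> k (?W A) < ennreal (?T i) \<and>
      ennreal (?T i) \<le> \<tau> (Suc k) (?W A) \<and> up k (?W A) - dn k (?W A) < w (?T i)"] by blast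
  have "i \<in> J \<longleftrightarrow> up k (?W J) - dn k (?W J) < w (?T i)"
    if k: "\<tau> k (?W J) < ennreal (?T i)" "ennreal (?T i) \<le> \<tau> (Suc k) (?W J)" for k i
  proof -
    let ?P = "?W (J \<inter> {..<i})"
    have same: "path_at (?W J) y = path_at ?P y" if "y < ?T i" for y
      using jump_path_restrict[OF s d that] by simp
    have eq: "\<tau> k ?P = \<tau> k (?W J)" and ag: "agree_upto (\<tau> k (?W J)) (?W J) ?P"
      using stopping_time_determined_before[OF stopping k(1), of ?P] same by auto
    have x: "up k ?P = up k (?W J)" "dn k ?P = dn k (?W J)"
      using up_determined[OF _ ag] dn_determined[OF _ ag] less_trans[OF k(1) ennreal_less_top]
      by simp_all
    have next_: "ennreal (?T i) \<le> \<tau> (Suc k) ?P"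
    proof (rule ccontr)
      assume "\<not> ?thesis"
      then have "\<tau> (Suc k) ?P < ennreal (?T i)" by simp
      from stopping_time_determined_before(1)[OF stopping this, of "?W J"] same this k(2)
      show False by auto
    qed
    \<comment> \<open>The rule defining \<open>J\<close> quantifies over all periods, but only one of them contains the grid point.\<close>
    have uniq: "k' = k"
      if k': "\<tau> k' ?P < ennreal (?T i)" "ennreal (?T i) \<le> \<tau> (Suc k') ?P" for k'
    proof (rule ccontr)
      assume "k' \<noteq> k"
      then consider "Suc k \<le> k'" | "Suc k' \<le> k" by linarith
      then show False
      proof cases
        case 1
        from lift_Suc_mono_le[of "\<lambda>k. \<tau> k ?P", OF mono this] next_ k'(1) show False by auto
      next
        case 2
        from lift_Suc_mono_le[of "\<lambda>k. \<tau> k ?P", OF mono this] eq k(1) k'(2) show False by auto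
      qed
    qed
    show ?thesis unfolding J using uniq x eq k(1) next_ by metis
  qed
  then show ?thesis using that by blast
qed

text \<open>
  The gain in each period is compared with the compensated target \<open>\<psi>\<close>, which is constant after \<open>t\<close>.
  Each period is cut at \<open>t\<close>, where the weight changes from \<open>q\<close> to \<open>0\<close>; each of the two parts
  contributes an error, whence the factor \<open>2\<close>. The error does not depend on
  \<open>u\<close>, which is what allows passing to the lower limit of the capital along one fixed path.
\<close>

lemma profit_le_on_adversarial_path:
  assumes "0 \<le> lo" "lo \<le> r" "r \<le> hi" "0 \<le> s" "s \<le> t" and d: "0 < d" "r * d \<le> 1"
  obtains W where "agree_upto (ennreal s) \<omega> W"
    "\<And>u. t \<le> u \<Longrightarrow> profit lo hi u W \<le> profit lo hi s \<omega> + q * (N t W - N s W) - q * r * (t - s)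
       + (\<Sum>k<m. 2 * (\<bar>q\<bar> + B k) * r) * d"
proof -
  define C where "C = (\<Sum>k<m. 2 * (\<bar>q\<bar> + B k) * r)"
  define w where "w y = (if y \<le> t then q else 0)" for y :: real
  obtain J where J: "\<And>k i. \<lbrakk>\<tau> k (jump_path \<omega> s d J) < ennreal (s + (real i + 1) * d);
           ennreal (s + (real i + 1) * d) \<le> \<tau> (Suc k) (jump_path \<omega> s d J)\<rbrakk>
     \<Longrightarrow> i \<in> J \<longleftrightarrow> up k (jump_path \<omega> s d J) - dn k (jump_path \<omega> s d J) < w (s + (real i + 1) * d)"
    using adversarial_jumps[OF \<open>0 \<le> s\<close> \<open>0 < d\<close>, of \<omega> w] by blast
  define W where "W = jump_path \<omega> s d J"
  have ag: "agree_upto (ennreal s) \<omega> W"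
    unfolding W_def using jump_path_agree_start[OF \<open>0 \<le> s\<close> \<open>0 < d\<close>] .
  have bound: "profit lo hi u W \<le> profit lo hi s W + q * (N t W - N s W) - q * r * (t - s) + C * d" if u: "t \<le> u" for u
  proof -
    define \<psi> where "\<psi> y = q * N (min y t) W - q * r * min y t" for y
    define a where "a k = stopped (\<tau> k) u W" for k
    define G where "G k y = gain lo hi (up k W) (dn k W) W y" for k y
    define F where "F k y = G k y - \<psi> y" for k y
    have su: "s \<le> u" "0 \<le> u" using u assms by auto
    have a_mono: "a k \<le> a (Suc k)" for k unfolding a_def using mono stopped_mono by metis
    have a_bd: "0 \<le> a k" "a k \<le> u" for k unfolding a_def using stopped_bounds[OF su(2)] by auto
    have as: "stopped (\<tau> k) s W = min (a k) s" for k
      unfolding a_def using stopped_min \<open>0 \<le> s\<close> su by blast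
    have ends: "a 0 = 0" "a m = u" unfolding a_def first last stopped_def using su by auto
    \<comment> \<open>Only the part of a period after \<open>s\<close> matters, hence the maxima with \<open>s\<close>.\<close>
    have step: "F k (max (a (Suc k)) s) - F k (max (a k) s) \<le> 2 * (\<bar>q\<bar> + B k) * r * d" for k
    proof -
      define x where "x = max (a k) s"
      define y where "y = max (a (Suc k)) s"
      have xy: "s \<le> x" "x \<le> y" using a_mono[of k] by (auto simp: x_def y_def)
      have rule: "i \<in> J \<longleftrightarrow> up k W - dn k W < w (s + (real i + 1) * d)"
        if T: "x < s + (real i + 1) * d" "s + (real i + 1) * d \<le> y" for i
      proof -
        let ?T = "s + (real i + 1) * d"
        have "y \<le> u" using a_bd su by (auto simp: y_def)
        then have Tu: "0 \<le> ?T" "?T \<le> u" using T xy \<open>0 \<le> s\<close> by auto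
        have "a k < ?T" using T by (auto simp: x_def)
        then have 1: "\<tau> k W < ennreal ?T" unfolding a_def using stopped_less_iff[OF Tu] by simp
        have "\<not> a (Suc k) < ?T" using T xy by (auto simp: y_def)
        then have 2: "ennreal ?T \<le> \<tau> (Suc k) W"
          unfolding a_def using stopped_less_iff[OF Tu] by (simp add: not_less)
        show ?thesis using J[of k i] 1 2 unfolding W_def by blast
      qed
      note * = gain_on_uniform_jumps[OF \<open>0 \<le> lo\<close> \<open>lo \<le> r\<close> \<open>r \<le> hi\<close> up_nonneg[of k W] dn_nonneg[of k W] d \<open>0 \<le> s\<close> _ _ W_def]
      have 1: "G k (min y t) - G k (min x t) \<le> q * (N (min y t) W - N (min x t) W)
          - q * r * (min y t - min x t) + (\<bar>q\<bar> + dn k W) * r * d"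
        unfolding G_def
      proof (rule *)
        fix i assume "min x t < s + (real i + 1) * d" "s + (real i + 1) * d \<le> min y t"
        then show "i \<in> J \<longleftrightarrow> up k W - dn k W < q" using rule[of i] by (auto simp: w_def)
      qed (use xy assms in auto)
      have 2: "G k (max y t) - G k (max x t) \<le> 0 * (N (max y t) W - N (max x t) W)
          - 0 * r * (max y t - max x t) + (\<bar>0\<bar> + dn k W) * r * d"
        unfolding G_def
      proof (rule *)
        fix i assume "max x t < s + (real i + 1) * d" "s + (real i + 1) * d \<le> max y t"
        then show "i \<in> J \<longleftrightarrow> up k W - dn k W < 0" using rule[of i] by (auto simp: w_def)
      qed (use xy assms in auto)
      have "G k y - G k x = (G k (min y t) - G k (min x t)) + (G k (max y t) - G k (max x t))"
        by (auto simp: min_def max_def)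
      then have "F k y - F k x \<le> (\<bar>q\<bar> + 2 * dn k W) * (r * d)"
        using 1 2 by (simp add: F_def \<psi>_def algebra_simps)
      also have "\<dots> \<le> (2 * (\<bar>q\<bar> + B k)) * (r * d)"
        using dn_le[of k W] assms d by (intro mult_right_mono) auto
      finally show ?thesis by (simp add: x_def y_def mult.assoc)
    qed
    have tele: "(\<Sum>k<m. \<psi> (max (a (Suc k)) s) - \<psi> (max (a k) s)) =
        \<psi> (max (a m) s) - \<psi> (max (a 0) s)"
      by (rule sum_lessThan_telescope)
    \<comment> \<open>\<open>max\<close> and \<open>min\<close> of two numbers are those numbers in some order.\<close>
    have split: "G k (a j) - G k (min (a j) s) = G k (max (a j) s) - G k s" for j k
      by (auto simp: min_def max_def)
    have "profit lo hi u W - profit lo hi s W =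
        (\<Sum>k<m. (G k (a (Suc k)) - G k (a k)) - (G k (min (a (Suc k)) s) - G k (min (a k) s)))"
      unfolding profit_def as by (simp only: a_def G_def sum_subtractf)
    also have "\<dots> = (\<Sum>k<m. G k (max (a (Suc k)) s) - G k (max (a k) s))"
    proof (rule sum.cong[OF refl])
      fix k
      show "(G k (a (Suc k)) - G k (a k)) - (G k (min (a (Suc k)) s) - G k (min (a k) s)) =
        G k (max (a (Suc k)) s) - G k (max (a k) s)"
        using split[of k k] split[of k "Suc k"] by linarith
    qed
    also have "\<dots> = (\<Sum>k<m. (F k (max (a (Suc k)) s) - F k (max (a k) s)) +
                      (\<psi> (max (a (Suc k)) s) - \<psi> (max (a k) s)))"
      by (simp add: F_def)
    also have "\<dots> = (\<Sum>k<m. F k (max (a (Suc k)) s) - F k (max (a k) s)) +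
        (\<psi> (max (a m) s) - \<psi> (max (a 0) s))"
      unfolding sum.distrib tele ..
    also have "\<dots> \<le> (\<Sum>k<m. 2 * (\<bar>q\<bar> + B k) * r * d) + (\<psi> (max (a m) s) - \<psi> (max (a 0) s))"
      using step by (intro add_right_mono sum_mono) auto
    also have "(\<Sum>k<m. 2 * (\<bar>q\<bar> + B k) * r * d) = C * d"
      unfolding C_def by (rule sum_distrib_right[symmetric])
    also have "\<psi> (max (a m) s) - \<psi> (max (a 0) s) = q * (N t W - N s W) - q * r * (t - s)"
      using ends su u assms by (simp add: \<psi>_def max_def algebra_simps)
    finally show ?thesis by simp
  qed
  then show ?thesis
    using that[OF ag] profit_determined[OF \<open>0 \<le> s\<close> ag] by (simp add: C_def)
qed

end

text \<open>
  If the capital at time \<open>s\<close> were below \<open>q * r * (t - s)\<close>, then for small \<open>d\<close> its lower limit on the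
  adversarial path would stay below the target.
\<close>

lemma upper_expectation_ge_rate:
  fixes lo hi r q s t :: real
  assumes "0 \<le> lo" "lo \<le> r" "r \<le> hi" "0 \<le> s" "s \<le> t"
  shows "ereal (q * r * (t - s)) \<le>
    upper_expectation lo hi (\<lambda>\<omega>'. Some (ereal (q * (N t \<omega>' - N s \<omega>')))) (const_time s) \<omega>"
  unfolding upper_expectation_def
proof (rule Inf_greatest)
  fix z
  assume "z \<in> {ereal (K (enn2real (const_time s \<omega>)) \<omega>) | K.
            K \<in> capital_processes lo hi \<and> process_Inf K > -\<infinity> \<and>
            (\<forall>\<omega>'\<in>indist (const_time s) \<omega>.
              process_liminf K \<omega>' \<ge> the (Some (ereal (q * (N t \<omega>' - N s \<omega>')))))}"
  then obtain n \<tau> gu gd c where strat: "elementary_strategy n \<tau> gu gd"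
    and z: "z = ereal (capital lo hi n \<tau> gu gd c s \<omega>)"
    and lim: "\<And>\<omega>'. agree_upto (ennreal s) \<omega> \<omega>' \<Longrightarrow>
      ereal (q * (N t \<omega>' - N s \<omega>')) \<le> process_liminf (capital lo hi n \<tau> gu gd c) \<omega>'"
    unfolding capital_processes_def const_time_def indist_def using \<open>0 \<le> s\<close> by auto
  let ?K = "capital lo hi n \<tau> gu gd c"
  obtain \<tau>' up dn B where cov: "covering_strategy (n + 2) \<tau>' up dn B"
    and cap: "\<And>u \<omega>. 0 \<le> u \<Longrightarrow> ?K u \<omega> = c + covering_strategy.profit (n + 2) \<tau>' up dn lo hi u \<omega>"
    by (rule capital_eq_covering_profit[OF strat]) (rule that)
  interpret covering_strategy "n + 2" \<tau>' up dn B by (rule cov)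
  define C where "C = (\<Sum>k<n+2. 2 * (\<bar>q\<bar> + B k) * r)"
  have B0: "0 \<le> B k" for k using dn_nonneg[of k \<omega>] dn_le[of k \<omega>] by simp
  have C0: "0 \<le> C" unfolding C_def using B0 assms by (intro sum_nonneg) auto
  have main: "q * r * (t - s) \<le> ?K s \<omega> + C * d" if d: "0 < d" "r * d \<le> 1" for d
  proof -
    obtain W where ag: "agree_upto (ennreal s) \<omega> W"
      and bound: "\<And>u. t \<le> u \<Longrightarrow> profit lo hi u W \<le>
        profit lo hi s \<omega> + q * (N t W - N s W) - q * r * (t - s) + C * d"
      using profit_le_on_adversarial_path[OF assms d, of \<omega> q] unfolding C_def by blast
    have "\<forall>\<^sub>F u in at_top. ereal (?K u W) \<le> ereal (?K s \<omega> + q * (N t W - N s W) - q * r * (t - s) + C * d)"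
      using eventually_ge_at_top[of t]
    proof eventually_elim
      case (elim u)
      with cap[of u W] cap[of s \<omega>] bound[of u] assms show ?case by simp
    qed
    then have "process_liminf ?K W \<le> Liminf at_top (\<lambda>u::real. ereal (?K s \<omega> + q * (N t W - N s W) - q * r * (t - s) + C * d))"
      unfolding process_liminf_def by (rule Liminf_mono)
    also have "\<dots> = ereal (?K s \<omega> + q * (N t W - N s W) - q * r * (t - s) + C * d)"
      by (intro Liminf_const) simp
    finally have "ereal (q * (N t W - N s W)) \<le> \<dots>"
      using lim[OF ag] by (rule order_trans[rotated])
    then show ?thesis by simp
  qed
  have "q * r * (t - s) \<le> ?K s \<omega>"
  proof (rule field_le_epsilon)
    fix e :: real assume e: "0 < e"
    \<comment> \<open>The first entry ensures \<open>r * d \<le> 1\<close>, the second \<open>C * d \<le> e\<close>.\<close>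
    define d where "d = min (1 / (r + 1)) (e / (C + 1))"
    have r0: "0 \<le> r" using assms by simp
    have d: "0 < d" using r0 C0 e by (simp add: d_def)
    have "r * d \<le> r * (1 / (r + 1))" using r0 by (intro mult_left_mono) (auto simp: d_def)
    also have "\<dots> \<le> 1" using r0 by simp
    finally have "r * d \<le> 1" .
    moreover have "C * d \<le> C * (e / (C + 1))" using C0 by (intro mult_left_mono) (auto simp: d_def)
    moreover have "C * (e / (C + 1)) \<le> e" using C0 e by (simp add: field_simps)
    ultimately show "q * r * (t - s) \<le> ?K s \<omega> + e" using main[OF d] by linarith
  qed
  then show "ereal (q * r * (t - s)) \<le> z" by (simp add: z)
qed


section \<open>Superhedging in one period\<close>

text \<open>
  Constant stakes \<open>x\<close> (long) and \<open>y\<close> (short) are held from \<open>s\<close> until \<open>\<rho>\<close>. Losses on the long side are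
  bounded since the period is bounded; on the short side they are bounded by \<open>bdd\<close>, which for \<open>y > 0\<close>
  forces the position to be closed before too many jumps occur. From time \<open>t\<close> on the capital is constant, so its
  lower limit is its value at \<open>\<rho>\<close>.
\<close>

lemma upper_expectation_le_one_period:
  fixes lo hi s t x y c D :: real and \<rho> f :: "counting_path \<Rightarrow> real"
  assumes "0 \<le> lo" "0 \<le> hi" "0 \<le> s" "0 \<le> x" "0 \<le> y"
    and st: "stopping_time (\<lambda>\<omega>. ennreal (\<rho> \<omega>))"
    and \<rho>: "\<And>\<omega>. s \<le> \<rho> \<omega>" "\<And>\<omega>. \<rho> \<omega> \<le> t"
    and bdd: "\<And>\<omega>. y * (N (\<rho> \<omega>) \<omega> - N s \<omega>) \<le> D"
    and hedge: "\<And>\<omega>. f \<omega> \<le> c + x * (N (\<rho> \<omega>) \<omega> - N s \<omega> - hi * (\<rho> \<omega> - s)) +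
                          y * (lo * (\<rho> \<omega> - s) - (N (\<rho> \<omega>) \<omega> - N s \<omega>))"
  shows "upper_expectation lo hi (\<lambda>\<omega>'. Some (ereal (f \<omega>'))) (const_time s) \<omega> \<le> ereal c"
proof -
  define \<tau> where "\<tau> k = (if k = (1::nat) then const_time s else (\<lambda>\<omega>. ennreal (\<rho> \<omega>)))" for k
  define K where "K = capital lo hi 1 \<tau> (\<lambda>_ _. Some x) (\<lambda>_ _. Some y) c"
  have K: "K u \<omega> = c + x * (N (min (\<rho> \<omega>) u) \<omega> - N (min s u) \<omega> - hi * (min (\<rho> \<omega>) u - min s u)) +
      y * (lo * (min (\<rho> \<omega>) u - min s u) - (N (min (\<rho> \<omega>) u) \<omega> - N (min s u) \<omega>))" if "0 \<le> u" for u \<omega>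
  proof -
    have "stopped (\<tau> 1) u \<omega> = min s u" "stopped (\<tau> 2) u \<omega> = min (\<rho> \<omega>) u"
      using that \<rho>(1)[of \<omega>] \<open>0 \<le> s\<close> by (auto intro!: stopped_ennreal simp: \<tau>_def const_time_def)
    then show ?thesis by (simp add: K_def capital_def Let_def algebra_simps numeral_2_eq_2)
  qed
  have "elementary_strategy 1 \<tau> (\<lambda>_ _. Some x) (\<lambda>_ _. Some y)"
  proof -
    have "stopping_time (\<tau> k)" for k
      using st by (auto simp: \<tau>_def stopping_time_def const_time_def)
    moreover have "stake (\<tau> k) (\<lambda>_. Some z)" if "0 \<le> z" for k z
      using that by (auto simp: stake_def stop_measurable_def dom_def ran_def)
    moreover have "\<tau> 1 \<omega> \<le> \<tau> (1 + 1) \<omega>" for \<omega>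
      using \<rho>(1) by (auto simp: \<tau>_def const_time_def ennreal_leI)
    ultimately show ?thesis using assms by (auto simp: elementary_strategy_def)
  qed
  then have proc: "K \<in> capital_processes lo hi" unfolding capital_processes_def K_def by blast
  have lower: "min c (c - x * hi * (t - s) - D) \<le> K u \<omega>" if "0 \<le> u" for u \<omega>
  proof (cases "u < s")
    case True
    then have "K u \<omega> = c" using \<rho>(1)[of \<omega>] that by (simp add: K min_def)
    then show ?thesis by simp
  next
    case False
    define v where "v = min (\<rho> \<omega>) u"
    have v: "s \<le> v" "v \<le> \<rho> \<omega>" "v \<le> t" using False \<rho>[of \<omega>] by (auto simp: v_def)
    have "N s \<omega> \<le> N v \<omega>" "N v \<omega> \<le> N (\<rho> \<omega>) \<omega>" using v \<open>0 \<le> s\<close> by (auto intro: N_mono)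
    then have "0 \<le> x * (N v \<omega> - N s \<omega>)" "y * (N v \<omega> - N s \<omega>) \<le> y * (N (\<rho> \<omega>) \<omega> - N s \<omega>)"
      using assms by (auto intro: mult_left_mono)
    moreover have "x * hi * (v - s) \<le> x * hi * (t - s)" using v assms by (intro mult_left_mono) auto
    moreover have "0 \<le> y * (lo * (v - s))" using v assms by auto
    ultimately have "c - x * hi * (t - s) - D \<le>
        c + x * (N v \<omega> - N s \<omega> - hi * (v - s)) + y * (lo * (v - s) - (N v \<omega> - N s \<omega>))"
      using bdd[of \<omega>] by (simp add: right_diff_distrib mult.assoc)
    then show ?thesis using K[OF that, of \<omega>] False by (simp add: v_def[symmetric] min_absorb1)
  qed
  have "ereal (min c (c - x * hi * (t - s) - D)) \<le> process_Inf K"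
    unfolding process_Inf_def using lower by (intro INF_greatest) (simp del: ereal_min)
  then have inf: "process_Inf K > -\<infinity>" by (rule less_le_trans[rotated]) simp
  have lim: "process_liminf K \<omega>' \<ge> ereal (f \<omega>')" for \<omega>'
  proof -
    have "\<forall>\<^sub>F u in at_top. ereal (f \<omega>') \<le> ereal (K u \<omega>')"
      using eventually_ge_at_top[of t]
    proof eventually_elim
      case (elim u)
      with \<rho>[of \<omega>'] \<open>0 \<le> s\<close> have "0 \<le> u" "min (\<rho> \<omega>') u = \<rho> \<omega>'" "min s u = s" by auto
      then show ?case using hedge[of \<omega>'] K[of u \<omega>'] by simp
    qed
    then show ?thesis unfolding process_liminf_def by (rule Liminf_bounded)
  qed
  have "K s \<omega> = c" using \<rho>(1)[of \<omega>] \<open>0 \<le> s\<close> by (simp add: K min_absorb2)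
  then show ?thesis unfolding upper_expectation_def
    by (intro Inf_lower) (use proc inf lim \<open>0 \<le> s\<close> in \<open>auto intro!: exI[of _ K] simp: const_time_def\<close>)
qed

text \<open>
  The first time after \<open>s\<close> at which \<open>M\<close> jumps have occurred, capped at \<open>t\<close>. Right-continuity makes the
  infimum attained, and so decidable from the path up to and including it. Unit jumps
  prevent the path from overshooting the level.
\<close>

lemma stopping_at_level:
  fixes s t :: real and M :: nat
  assumes "0 \<le> s" "s \<le> t"
  obtains \<rho> :: "counting_path \<Rightarrow> real" where
    "stopping_time (\<lambda>\<omega>. ennreal (\<rho> \<omega>))" "\<And>\<omega>. s \<le> \<rho> \<omega>" "\<And>\<omega>. \<rho> \<omega> \<le> t"
    "\<And>\<omega>. N (\<rho> \<omega>) \<omega> - N s \<omega> \<le> M" "\<And>\<omega>. \<rho> \<omega> = t \<or> M \<le> N (\<rho> \<omega>) \<omega> - N s \<omega>"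
proof -
  define A where "A \<omega> = {v. s \<le> v \<and> v \<le> t \<and> (v = t \<or> path_at \<omega> s + M \<le> path_at \<omega> v)}" for \<omega>
  define \<rho> where "\<rho> \<omega> = Inf (A \<omega>)" for \<omega>
  have tA: "t \<in> A \<omega>" for \<omega> using assms by (auto simp: A_def)
  have bdd: "bdd_below (A \<omega>)" for \<omega> by (rule bdd_belowI[of _ s]) (auto simp: A_def)
  have low: "\<rho> \<omega> \<le> v" if "v \<in> A \<omega>" for v \<omega> unfolding \<rho>_def using that bdd by (rule cInf_lower)
  have s\<rho>: "s \<le> \<rho> \<omega>" for \<omega> unfolding \<rho>_def using tA by (intro cInf_greatest) (auto simp: A_def)
  have attained: "\<rho> \<omega> \<in> A \<omega>" for \<omega>
  proof (cases "\<rho> \<omega> = t")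
    case False
    then have "\<rho> \<omega> < t" using low[OF tA, of \<omega>] by simp
    have "0 \<le> \<rho> \<omega>" using s\<rho>[of \<omega>] assms by simp
    from path_at_right_constant[OF this, of \<omega>]
    obtain e where e: "\<rho> \<omega> < e" "\<And>x. \<rho> \<omega> < x \<Longrightarrow> x < e \<Longrightarrow> path_at \<omega> x = path_at \<omega> (\<rho> \<omega>)"
      by (auto simp: eventually_at_right_field)
    obtain v where v: "v \<in> A \<omega>" "v < min e t"
      using cInf_lessD[of "A \<omega>" "min e t"] tA e(1) \<open>\<rho> \<omega> < t\<close> by (auto simp: \<rho>_def)
    have "path_at \<omega> v = path_at \<omega> (\<rho> \<omega>)"
      using e(2)[of v] v(2) low[OF v(1)] by (cases "v = \<rho> \<omega>") auto
    then show ?thesis using v s\<rho>[of \<omega>] \<open>\<rho> \<omega> < t\<close> by (auto simp: A_def)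
  qed (use tA in simp)
  then have \<rho>t: "\<rho> \<omega> \<le> t" for \<omega> by (auto simp: A_def)
  have st: "stopping_time (\<lambda>\<omega>. ennreal (\<rho> \<omega>))"
    unfolding stopping_time_def
  proof (intro allI impI)
    fix \<omega>1 \<omega>2 assume ag: "agree_upto (ennreal (\<rho> \<omega>1)) \<omega>1 \<omega>2"
    have eq: "path_at \<omega>1 x = path_at \<omega>2 x" if "0 \<le> x" "x \<le> \<rho> \<omega>1" for x
      using ag that by (auto simp: agree_upto_def ennreal_leI)
    have mem: "v \<in> A \<omega>1 \<longleftrightarrow> v \<in> A \<omega>2" if "v \<le> \<rho> \<omega>1" for v
      using eq[of s] eq[of v] that s\<rho>[of \<omega>1] assms by (auto simp: A_def)
    have "\<rho> \<omega>2 \<le> \<rho> \<omega>1" using attained[of \<omega>1] mem low by auto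
    moreover from this have "\<rho> \<omega>1 \<le> \<rho> \<omega>2" using attained[of \<omega>2] mem low by auto
    ultimately show "ennreal (\<rho> \<omega>1) = ennreal (\<rho> \<omega>2)" by simp
  qed
  have up: "path_at \<omega> (\<rho> \<omega>) \<le> path_at \<omega> s + M" for \<omega>
  proof (cases "\<rho> \<omega> = s")
    case False
    then have "s < \<rho> \<omega>" "0 < \<rho> \<omega>" using s\<rho>[of \<omega>] assms by auto
    obtain l where l: "\<forall>\<^sub>F x in at_left (\<rho> \<omega>). path_at \<omega> x = l"
        "path_at \<omega> (\<rho> \<omega>) = l \<or> path_at \<omega> (\<rho> \<omega>) = l + 1"
      using path_at_left_constant[OF \<open>0 < \<rho> \<omega>\<close>] by blast
    have "\<forall>\<^sub>F x in at_left (\<rho> \<omega>). s < x \<and> x < \<rho> \<omega>"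
      using \<open>s < \<rho> \<omega>\<close> by (auto simp: eventually_at_left[of s])
    with l(1) have "\<forall>\<^sub>F x in at_left (\<rho> \<omega>). path_at \<omega> x = l \<and> s < x \<and> x < \<rho> \<omega>"
      by eventually_elim auto
    then obtain v where v: "path_at \<omega> v = l" "s < v" "v < \<rho> \<omega>"
      using eventually_happens[of _ "at_left (\<rho> \<omega>)"] by auto
    then have "v \<notin> A \<omega>" using low[of v \<omega>] by auto
    then have "l < path_at \<omega> s + M" using v \<rho>t[of \<omega>] by (auto simp: A_def)
    then show ?thesis using l(2) by auto
  qed simp
  show ?thesis
  proof (rule that[OF st s\<rho> \<rho>t])
    show "N (\<rho> \<omega>) \<omega> - N s \<omega> \<le> M" for \<omega> using up[of \<omega>] by (simp add: N_def)
    show "\<rho> \<omega> = t \<or> M \<le> N (\<rho> \<omega>) \<omega> - N s \<omega>" for \<omega>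
      using attained[of \<omega>] by (auto simp: A_def N_def)
  qed
qed

lemma upper_expectation_increment_le:
  assumes "0 \<le> lo" "lo \<le> hi" "0 \<le> s" "s \<le> t"
  shows "upper_expectation lo hi (\<lambda>\<omega>'. Some (ereal (N t \<omega>' - N s \<omega>'))) (const_time s) \<omega>
           \<le> ereal (hi * (t - s))"
  by (rule upper_expectation_le_one_period[where x = 1 and y = 0 and D = 0 and \<rho> = "\<lambda>_. t" and t = t])
     (use assms in \<open>auto simp: stopping_time_def\<close>)

text \<open>
  The long stake \<open>\<delta> = lo * (t - s) / M\<close> costs at most \<open>\<delta> * hi * (t - s)\<close>, which is at most \<open>e\<close> for
  large \<open>M\<close>. If the \<open>M\<close>-th jump comes before \<open>t\<close>, the short stake may have earned less than the premium
  \<open>lo * (t - s)\<close>, but the long stake contributes \<open>\<delta> * M\<close>, exactly that premium; and jumps after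
  stopping only lower the target.
\<close>

lemma upper_expectation_neg_increment_le:
  assumes "0 \<le> lo" "lo \<le> hi" "0 \<le> s" "s \<le> t"
  shows "upper_expectation lo hi (\<lambda>\<omega>'. Some (ereal (- (N t \<omega>' - N s \<omega>')))) (const_time s) \<omega>
           \<le> ereal (- lo * (t - s))"
proof (rule ereal_le_epsilon2)
  fix e :: real assume e: "0 < e"
  obtain M' :: nat where M': "lo * (t - s) * (hi * (t - s)) / e < real M'" using reals_Archimedean2 by blast
  define M where "M = Suc M'"
  define \<delta> where "\<delta> = lo * (t - s) / real M"
  have M0: "0 < real M" by (simp add: M_def)
  have \<delta>0: "0 \<le> \<delta>" using assms by (simp add: \<delta>_def)
  have "lo * (t - s) * (hi * (t - s)) \<le> e * real M"
    using M' e by (simp add: M_def field_simps)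
  then have cost: "\<delta> * (hi * (t - s)) \<le> e"
    using M0 by (simp add: \<delta>_def field_simps)
  obtain \<rho> where \<rho>: "stopping_time (\<lambda>\<omega>. ennreal (\<rho> \<omega>))" "\<And>\<omega>. s \<le> \<rho> \<omega>" "\<And>\<omega>. \<rho> \<omega> \<le> t"
    "\<And>\<omega>. N (\<rho> \<omega>) \<omega> - N s \<omega> \<le> M" "\<And>\<omega>. \<rho> \<omega> = t \<or> M \<le> N (\<rho> \<omega>) \<omega> - N s \<omega>"
    using stopping_at_level[OF \<open>0 \<le> s\<close> \<open>s \<le> t\<close>, where M = M] by blast
  have "upper_expectation lo hi (\<lambda>\<omega>'. Some (ereal (- (N t \<omega>' - N s \<omega>')))) (const_time s) \<omega>
           \<le> ereal (- lo * (t - s) + \<delta> * (hi * (t - s)))"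
  proof (rule upper_expectation_le_one_period[where x = \<delta> and y = 1 and D = M and \<rho> = \<rho> and t = t])
    fix \<omega>'
    let ?D = "N (\<rho> \<omega>') \<omega>' - N s \<omega>'"
    have mono: "N (\<rho> \<omega>') \<omega>' \<le> N t \<omega>'" "N s \<omega>' \<le> N (\<rho> \<omega>') \<omega>'"
      using \<rho>(2,3)[of \<omega>'] assms by (auto intro!: N_mono)
    have 1: "\<delta> * (hi * (\<rho> \<omega>' - s)) \<le> \<delta> * (hi * (t - s))"
      using \<delta>0 \<rho>(3)[of \<omega>'] assms by (intro mult_left_mono) auto
    have 2: "lo * (t - s) \<le> \<delta> * ?D + lo * (\<rho> \<omega>' - s)"
    proof (cases "\<rho> \<omega>' = t")
      case True
      then show ?thesis using \<delta>0 mono by simp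
    next
      case False
      then have "\<delta> * M \<le> \<delta> * ?D" using \<rho>(5)[of \<omega>'] \<delta>0 by (intro mult_left_mono) auto
      moreover have "\<delta> * M = lo * (t - s)" using M0 by (simp add: \<delta>_def)
      moreover have "0 \<le> lo * (\<rho> \<omega>' - s)" using \<rho>(2)[of \<omega>'] assms by simp
      ultimately show ?thesis by simp
    qed
    show "- (N t \<omega>' - N s \<omega>') \<le> - lo * (t - s) + \<delta> * (hi * (t - s)) +
        \<delta> * (N (\<rho> \<omega>') \<omega>' - N s \<omega>' - hi * (\<rho> \<omega>' - s)) +
        1 * (lo * (\<rho> \<omega>' - s) - (N (\<rho> \<omega>') \<omega>' - N s \<omega>'))"
      using 1 2 mono by (simp add: right_diff_distrib)
  qed (use assms \<rho> \<delta>0 in auto)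
  also have "\<dots> \<le> ereal (- lo * (t - s)) + ereal e" using cost by simp
  finally show "upper_expectation lo hi (\<lambda>\<omega>'. Some (ereal (- (N t \<omega>' - N s \<omega>')))) (const_time s) \<omega>
           \<le> ereal (- lo * (t - s)) + ereal e" .
qed


theorem proposition5:
  fixes lo hi s t :: real and \<omega> :: counting_path
  assumes "0 \<le> lo" and "lo \<le> hi" and "0 \<le> s" and "s \<le> t"
  shows "upper_expectation lo hi (\<lambda>\<omega>'. Some (ereal (N t \<omega>' - N s \<omega>'))) (const_time s) \<omega>
           = ereal (hi * (t - s))
       \<and> lower_expectation lo hi (\<lambda>\<omega>'. Some (ereal (N t \<omega>' - N s \<omega>'))) (const_time s) \<omega>
           = ereal (lo * (t - s))"
proof
  show "upper_expectation lo hi (\<lambda>\<omega>'. Some (ereal (N t \<omega>' - N s \<omega>'))) (const_time s) \<omega>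
           = ereal (hi * (t - s))"
    using upper_expectation_increment_le[OF assms, of \<omega>]
      upper_expectation_ge_rate[of lo hi hi s t 1 \<omega>] assms
    by (intro antisym) auto
  have "upper_expectation lo hi (\<lambda>\<omega>'. Some (ereal (- (N t \<omega>' - N s \<omega>')))) (const_time s) \<omega>
           = ereal (- lo * (t - s))"
    using upper_expectation_neg_increment_le[OF assms, of \<omega>]
      upper_expectation_ge_rate[of lo lo hi s t "-1" \<omega>] assms
    by (intro antisym) auto
  then show "lower_expectation lo hi (\<lambda>\<omega>'. Some (ereal (N t \<omega>' - N s \<omega>'))) (const_time s) \<omega>
           = ereal (lo * (t - s))"
    by (simp add: lower_expectation_def)
qed

end
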